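(* Let $\Omega$ be a set and $\mathcal{B}$ a $\sigma$-algebra on $\Omega$. Suppose that $\mathcal{B}$ is finite, that $\mu$ is a 2-alternating capacity defined on $\mathcal{B}$, and that $\nu$ is a 2-monotone capacity defined on $\mathcal{B}$. If $\mu\geq\nu$, then there exists a probability measure $P$ on $\mathcal{B}$ such that $\mu\geq P\geq\nu$.
   Context: A set function $c:\mathcal{B}\to[0,1]$ is a capacity if $c(\Omega)=1$, $c(\emptyset)=0$, and $c(A)\leq c(B)$ for all $A,B\in\mathcal{B}$ with $A\subseteq B$. A capacity $c$ is 2-alternating if $c(A\cup B)+c(A\cap B)\leq c(A)+c(B)$ for all $A,B\in\mathcal{B}$; it is 2-monotone if $c(A\cup B)+c(A\cap B)\geq c(A)+c(B)$ for all $A,B\in\mathcal{B}$; it is called a probability measure if $c(A\cup B)+c(A\cap B)=c(A)+c(B)$ for all $A,B\in\mathcal{B}$. For capacities $c_1,c_2$ on $\mathcal{B}$, $c_1\geq c_2$ means $c_1(A)\geq c_2(A)$ for all $A\in\mathcal{B}$. *)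

theory Defs
  imports "HOL-Analysis.Sigma_Algebra"
begin

text \<open>
  A set function on \<open>\<B>\<close> with values in \<open>[0,1]\<close> is encoded as a total function
  \<open>'a set \<Rightarrow> real\<close>; only its values on members of \<open>\<B>\<close> are constrained or compared.
\<close>

definition capacity :: "'a set \<Rightarrow> 'a set set \<Rightarrow> ('a set \<Rightarrow> real) \<Rightarrow> bool" where
  "capacity \<Omega> \<B> c \<longleftrightarrow>
     c \<in> \<B> \<rightarrow> {0..1} \<and> c \<Omega> = 1 \<and> c {} = 0 \<and>
     (\<forall>A\<in>\<B>. \<forall>B\<in>\<B>. A \<subseteq> B \<longrightarrow> c A \<le> c B)"

definition two_alternating_capacity :: "'a set \<Rightarrow> 'a set set \<Rightarrow> ('a set \<Rightarrow> real) \<Rightarrow> bool" where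
  "two_alternating_capacity \<Omega> \<B> c \<longleftrightarrow>
     capacity \<Omega> \<B> c \<and> (\<forall>A\<in>\<B>. \<forall>B\<in>\<B>. c (A \<union> B) + c (A \<inter> B) \<le> c A + c B)"

definition two_monotone_capacity :: "'a set \<Rightarrow> 'a set set \<Rightarrow> ('a set \<Rightarrow> real) \<Rightarrow> bool" where
  "two_monotone_capacity \<Omega> \<B> c \<longleftrightarrow>
     capacity \<Omega> \<B> c \<and> (\<forall>A\<in>\<B>. \<forall>B\<in>\<B>. c (A \<union> B) + c (A \<inter> B) \<ge> c A + c B)"

text \<open>
  Probability measures are the modular capacities, so the definition asks only for finite
  additivity. It is applied to finite \<open>\<B>\<close>, where this is the same as countable additivity.
\<close>

definition probability_capacity :: "'a set \<Rightarrow> 'a set set \<Rightarrow> ('a set \<Rightarrow> real) \<Rightarrow> bool" where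
  "probability_capacity \<Omega> \<B> c \<longleftrightarrow>
     capacity \<Omega> \<B> c \<and> (\<forall>A\<in>\<B>. \<forall>B\<in>\<B>. c (A \<union> B) + c (A \<inter> B) = c A + c B)"

definition capacity_ge :: "'a set set \<Rightarrow> ('a set \<Rightarrow> real) \<Rightarrow> ('a set \<Rightarrow> real) \<Rightarrow> bool" where
  "capacity_ge \<B> c\<^sub>1 c\<^sub>2 \<longleftrightarrow> (\<forall>A\<in>\<B>. c\<^sub>1 A \<ge> c\<^sub>2 A)"

end

theory Submission
  imports Defs
begin

text \<open>
  On the atoms of \<open>\<B>\<close> this is Frank's discrete sandwich theorem, proved by fixing the value
  \<open>t\<close> of an additive set function at one atom \<open>a\<close> at a time. The constraints on \<open>t\<close> are
  \<open>\<nu> (A \<union> a) - \<mu> A \<le> t \<le> \<mu> (B \<union> a) - \<nu> B\<close> for all \<open>A\<close> and \<open>B\<close> disjoint from \<open>a\<close>; they are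
  compatible since both sides can be uncrossed to \<open>A \<union> B \<union> a\<close> and \<open>A \<inter> B\<close>. Then
  \<open>min (\<mu> A) (\<mu> (A \<union> a) - t)\<close> and \<open>max (\<nu> A) (\<nu> (A \<union> a) - t)\<close> satisfy the same hypotheses on
  the remaining atoms. Monotonicity of the resulting additive set function follows from
  \<open>\<nu> \<ge> 0\<close>.
\<close>

theorem discrete_sandwich:
  fixes f g :: "'b set \<Rightarrow> real"
  assumes "finite E"
    and "\<And>A B. A \<subseteq> E \<Longrightarrow> B \<subseteq> E \<Longrightarrow> f (A \<union> B) + f (A \<inter> B) \<le> f A + f B"
    and "\<And>A B. A \<subseteq> E \<Longrightarrow> B \<subseteq> E \<Longrightarrow> g (A \<union> B) + g (A \<inter> B) \<ge> g A + g B"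
    and "\<And>A. A \<subseteq> E \<Longrightarrow> g A \<le> f A"
    and "f {} = 0" and "g {} = 0"
  shows "\<exists>p. \<forall>A\<subseteq>E. g A \<le> sum p A \<and> sum p A \<le> f A"
  using assms
proof (induction E arbitrary: f g rule: finite_induct)
  case empty
  then show ?case by simp
next
  case (insert a E)
  note sub = insert.prems(1) and sup = insert.prems(2) and le = insert.prems(3)
  have uncross: "g (insert a A) - f A \<le> f (insert a B) - g B" if "A \<subseteq> E" "B \<subseteq> E" for A B
  proof -
    have [simp]: "A \<inter> insert a B = A \<inter> B" "insert a A \<inter> B = A \<inter> B"
      using that insert.hyps by auto
    have "f (insert a (A \<union> B)) + f (A \<inter> B) \<le> f A + f (insert a B)"
      using sub[of A "insert a B"] that by auto
    moreover have "g (insert a (A \<union> B)) + g (A \<inter> B) \<ge> g (insert a A) + g B"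
      using sup[of "insert a A" B] that by auto
    moreover have "g (insert a (A \<union> B)) \<le> f (insert a (A \<union> B))" "g (A \<inter> B) \<le> f (A \<inter> B)"
      using that by (auto intro!: le)
    ultimately show ?thesis by linarith
  qed
  \<comment> \<open>The least admissible value is taken; any value between the two families of
    bounds would do. \<open>Max\<close> is meaningful because \<open>Pow E\<close> is finite and
    nonempty.\<close>
  define t where "t = Max ((\<lambda>A. g (insert a A) - f A) ` Pow E)"
  have t_ge: "g (insert a A) - f A \<le> t" if "A \<subseteq> E" for A
    unfolding t_def using that insert.hyps by (intro Max_ge) auto
  have t_le: "t \<le> f (insert a B) - g B" if "B \<subseteq> E" for B
    unfolding t_def using that insert.hyps uncross by (subst Max_le_iff) auto
  define f' where "f' A = min (f A) (f (insert a A) - t)" for A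
  define g' where "g' A = max (g A) (g (insert a A) - t)" for A
  have "\<exists>p. \<forall>A\<subseteq>E. g' A \<le> sum p A \<and> sum p A \<le> f' A"
  proof (rule insert.IH)
    \<comment> \<open>Comparing either argument of \<open>max\<close> with either argument of
      \<open>min\<close> gives four inequalities: two are instances of \<open>le\<close>, the mixed
      ones are \<open>t_ge\<close> and \<open>t_le\<close>.\<close>
    have g'_le_f': "g' A \<le> f' A" if "A \<subseteq> E" for A
      using t_ge[OF that] t_le[OF that] le[of A] le[of "insert a A"] that
      unfolding f'_def g'_def by auto
    then show "g' A \<le> f' A" if "A \<subseteq> E" for A using that .
    have "f' {} \<le> 0" "0 \<le> g' {}"
      using insert.prems(4,5) by (auto simp: f'_def g'_def)
    then show "f' {} = 0" "g' {} = 0"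
      using g'_le_f'[of "{}"] by auto
    fix A B assume AB: "A \<subseteq> E" "B \<subseteq> E"
    have AB': "A \<subseteq> insert a E" "B \<subseteq> insert a E" "insert a A \<subseteq> insert a E"
        "insert a B \<subseteq> insert a E"
      using AB by auto
    have eq: "A \<inter> insert a B = A \<inter> B" "insert a A \<inter> B = A \<inter> B"
        "insert a A \<inter> insert a B = insert a (A \<inter> B)"
        "A \<union> insert a B = insert a (A \<union> B)" "insert a A \<union> B = insert a (A \<union> B)"
        "insert a A \<union> insert a B = insert a (A \<union> B)"
      using AB insert.hyps by auto
    \<comment> \<open>Each \<open>min\<close> on the right equals one of its arguments. In each of
      the four cases submodularity applies to the chosen sets, and \<open>t\<close> is subtracted
      equally often on both sides. In a mixed case \<open>a\<close> goes to the union and not to the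
      intersection.\<close>
    show "f' (A \<union> B) + f' (A \<inter> B) \<le> f' A + f' B"
      using sub[OF AB'(1,2)] sub[OF AB'(3,2)] sub[OF AB'(1,4)] sub[OF AB'(3,4)]
      unfolding f'_def eq by linarith
    show "g' (A \<union> B) + g' (A \<inter> B) \<ge> g' A + g' B"
      using sup[OF AB'(1,2)] sup[OF AB'(3,2)] sup[OF AB'(1,4)] sup[OF AB'(3,4)]
      unfolding g'_def eq by linarith
  qed
  then obtain p where p: "\<And>A. A \<subseteq> E \<Longrightarrow> g' A \<le> sum p A \<and> sum p A \<le> f' A"
    by blast
  \<comment> \<open>The first arguments of \<open>min\<close> and \<open>max\<close> give the bounds
    for sets without \<open>a\<close>, the second arguments those for sets containing
    \<open>a\<close>.\<close>
  have "g A \<le> sum (p(a := t)) A \<and> sum (p(a := t)) A \<le> f A" if A: "A \<subseteq> insert a E" for A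
  proof -
    let ?B = "A - {a}"
    have B: "?B \<subseteq> E" using A by auto
    then have fin: "finite ?B" using insert.hyps finite_subset by blast
    have sum_B: "sum (p(a := t)) ?B = sum p ?B"
      by (rule sum.cong) auto
    show ?thesis
    proof (cases "a \<in> A")
      case True
      then have "insert a ?B = A" by auto
      moreover have "sum (p(a := t)) (insert a ?B) = t + sum p ?B"
        unfolding sum_B[symmetric] using fin by (subst sum.insert) auto
      ultimately show ?thesis
        using p[OF B] by (simp add: f'_def g'_def)
    next
      case False
      then show ?thesis using p[OF B] sum_B by (simp add: f'_def g'_def)
    qed
  qed
  then show ?case by blast
qed

text \<open>In a finite algebra this is the smallest member containing \<open>x\<close>, that is,
  the atom around \<open>x\<close>. Outside \<Omega> the intersection is over the empty family and
  equals \<open>UNIV\<close>, hence the hypothesis \<open>x \<in> \<Omega>\<close> below.\<close>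

definition atom_of :: "'a set set \<Rightarrow> 'a \<Rightarrow> 'a set" where
  "atom_of \<B> x = \<Inter>{B\<in>\<B>. x \<in> B}"

lemma mem_atom_of: "x \<in> atom_of \<B> x"
  by (auto simp: atom_of_def)

lemma atom_of_subset: "A \<in> \<B> \<Longrightarrow> x \<in> A \<Longrightarrow> atom_of \<B> x \<subseteq> A"
  by (auto simp: atom_of_def)

context algebra
begin

lemma atom_of_in:
  assumes "finite M" "x \<in> \<Omega>"
  shows "atom_of M x \<in> M"
proof -
  have "finite {B\<in>M. x \<in> B}" "{B\<in>M. x \<in> B} \<noteq> {}"
    using assms by auto
  then show ?thesis
    using finite_INT[of "{B\<in>M. x \<in> B}" id] by (simp add: atom_of_def)
qed

text \<open>If \<open>x\<close> were outside the atom of \<open>z\<close>, removing that atom from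
  the atom of \<open>x\<close> would leave a member that contains \<open>x\<close> but misses
  \<open>z\<close>, against minimality.\<close>

lemma atom_of_eq:
  assumes "finite M" "x \<in> \<Omega>" "z \<in> atom_of M x"
  shows "atom_of M z = atom_of M x"
proof -
  have x: "atom_of M x \<in> M" by (rule atom_of_in[OF assms(1,2)])
  then have "z \<in> \<Omega>" using assms(3) sets_into_space by blast
  then have z: "atom_of M z \<in> M" by (rule atom_of_in[OF assms(1)])
  have "x \<in> atom_of M z"
  proof (rule ccontr)
    assume "x \<notin> atom_of M z"
    then have "atom_of M x \<subseteq> atom_of M x - atom_of M z"
      using x z mem_atom_of by (intro atom_of_subset) auto
    then show False using assms(3) mem_atom_of[of z M] by blast
  qed
  then show ?thesis
    using atom_of_subset[OF x assms(3)] atom_of_subset[OF z] by blast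
qed

lemma Union_atoms:
  assumes "A \<in> M"
  shows "\<Union>{D \<in> atom_of M ` \<Omega>. D \<subseteq> A} = A"
proof -
  have "x \<in> \<Union>{D \<in> atom_of M ` \<Omega>. D \<subseteq> A}" if "x \<in> A" for x
  proof -
    have "x \<in> \<Omega>" using that assms sets_into_space by blast
    then show ?thesis
      using atom_of_subset[OF assms that] mem_atom_of[of x M] by blast
  qed
  then show ?thesis by blast
qed

text \<open>Two atoms sharing a point coincide, so a point of both unions lies in one atom belonging
  to both families.\<close>

lemma Union_Int_atoms:
  assumes "finite M" "S \<subseteq> atom_of M ` \<Omega>" "T \<subseteq> atom_of M ` \<Omega>"
  shows "\<Union>(S \<inter> T) = \<Union>S \<inter> \<Union>T"
proof -
  have "C = D" if "C \<in> S" "D \<in> T" "z \<in> C" "z \<in> D" for C D z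
  proof -
    obtain x y where "x \<in> \<Omega>" "C = atom_of M x" "y \<in> \<Omega>" "D = atom_of M y"
      using subsetD[OF assms(2) \<open>C \<in> S\<close>] subsetD[OF assms(3) \<open>D \<in> T\<close>] by blast
    then show ?thesis
      using atom_of_eq[OF assms(1), of x z] atom_of_eq[OF assms(1), of y z]
        \<open>z \<in> C\<close> \<open>z \<in> D\<close> by simp
  qed
  then show ?thesis by blast
qed

end

theorem theorem2p3:
  fixes \<Omega> :: "'a set" and \<B> :: "'a set set" and \<mu> \<nu> :: "'a set \<Rightarrow> real"
  assumes "sigma_algebra \<Omega> \<B>"
    and "finite \<B>"
    and "two_alternating_capacity \<Omega> \<B> \<mu>"
    and "two_monotone_capacity \<Omega> \<B> \<nu>"
    and "capacity_ge \<B> \<mu> \<nu>"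
  shows "\<exists>P. probability_capacity \<Omega> \<B> P \<and> capacity_ge \<B> \<mu> P \<and> capacity_ge \<B> P \<nu>"
proof -
  interpret sigma_algebra \<Omega> \<B> by fact
  let ?E = "atom_of \<B> ` \<Omega>"
  define atoms_in where "atoms_in A = {D \<in> ?E. D \<subseteq> A}" for A
  have E_sub: "?E \<subseteq> \<B>" using atom_of_in[OF assms(2)] by blast
  then have fin_E: "finite ?E" using assms(2) finite_subset by blast
  have Un_in: "\<Union>S \<in> \<B>" if "S \<subseteq> ?E" for S
    using that E_sub fin_E by (intro finite_Union) (auto intro: finite_subset)
  have mu: "\<mu> (A \<union> B) + \<mu> (A \<inter> B) \<le> \<mu> A + \<mu> B" if "A \<in> \<B>" "B \<in> \<B>" for A B
    using assms(3) that by (auto simp: two_alternating_capacity_def)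
  have nu: "\<nu> (A \<union> B) + \<nu> (A \<inter> B) \<ge> \<nu> A + \<nu> B" if "A \<in> \<B>" "B \<in> \<B>" for A B
    using assms(4) that by (auto simp: two_monotone_capacity_def)
  have caps: "capacity \<Omega> \<B> \<mu>" "capacity \<Omega> \<B> \<nu>"
    using assms(3,4) by (auto simp: two_alternating_capacity_def two_monotone_capacity_def)
  \<comment> \<open>Taking unions of sets of atoms preserves binary unions and intersections, so
    both capacity inequalities carry over to subsets of \<open>?E\<close>.\<close>
  have "\<exists>p. \<forall>S\<subseteq>?E. \<nu> (\<Union>S) \<le> sum p S \<and> sum p S \<le> \<mu> (\<Union>S)"
  proof (rule discrete_sandwich[OF fin_E])
    show "\<mu> (\<Union>{}) = 0" "\<nu> (\<Union>{}) = 0" using caps by (auto simp: capacity_def)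
    show "\<nu> (\<Union>S) \<le> \<mu> (\<Union>S)" if "S \<subseteq> ?E" for S
      using assms(5) Un_in[OF that] by (auto simp: capacity_ge_def)
    fix S T assume ST: "S \<subseteq> ?E" "T \<subseteq> ?E"
    note eq = Union_Un_distrib Union_Int_atoms[OF assms(2) ST]
    show "\<mu> (\<Union>(S \<union> T)) + \<mu> (\<Union>(S \<inter> T)) \<le> \<mu> (\<Union>S) + \<mu> (\<Union>T)"
      unfolding eq using ST by (intro mu Un_in)
    show "\<nu> (\<Union>(S \<union> T)) + \<nu> (\<Union>(S \<inter> T)) \<ge> \<nu> (\<Union>S) + \<nu> (\<Union>T)"
      unfolding eq using ST by (intro nu Un_in)
  qed
  then obtain p where p: "\<And>S. S \<subseteq> ?E \<Longrightarrow> \<nu> (\<Union>S) \<le> sum p S \<and> sum p S \<le> \<mu> (\<Union>S)"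
    by blast
  define P where "P A = sum p (atoms_in A)" for A
  have atoms_in_E: "atoms_in A \<subseteq> ?E" for A by (auto simp: atoms_in_def)
  then have fin_at: "finite (atoms_in A)" for A using fin_E finite_subset by blast
  have bounds: "\<nu> A \<le> P A" "P A \<le> \<mu> A" if "A \<in> \<B>" for A
    using p[OF atoms_in_E, of A] Union_atoms[OF that] by (auto simp: P_def atoms_in_def)
  have modular: "P (A \<union> B) + P (A \<inter> B) = P A + P B" if "A \<in> \<B>" "B \<in> \<B>" for A B
  proof -
    \<comment> \<open>An atom cannot be split between \<open>A\<close> and \<open>B\<close>:
      whichever of them contains \<open>x\<close> contains the whole atom of
      \<open>x\<close>.\<close>
    have "D \<subseteq> A \<or> D \<subseteq> B" if "D \<in> ?E" "D \<subseteq> A \<union> B" for D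
    proof -
      obtain x where x: "D = atom_of \<B> x" using \<open>D \<in> ?E\<close> by blast
      then have "x \<in> A \<union> B" using \<open>D \<subseteq> A \<union> B\<close> mem_atom_of[of x \<B>] by blast
      then show ?thesis
        using x atom_of_subset[OF \<open>A \<in> \<B>\<close>] atom_of_subset[OF \<open>B \<in> \<B>\<close>] by auto
    qed
    then have "atoms_in (A \<union> B) = atoms_in A \<union> atoms_in B"
        "atoms_in (A \<inter> B) = atoms_in A \<inter> atoms_in B"
      by (auto simp: atoms_in_def)
    then show ?thesis
      using sum.union_inter[OF fin_at fin_at, of p A B] by (simp add: P_def)
  qed
  have nonneg: "0 \<le> P A" if "A \<in> \<B>" for A
    using bounds(1)[OF that] caps(2) that by (force simp: capacity_def)
  have "P A \<le> 1" if "A \<in> \<B>" for A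
    using bounds(2)[OF that] caps(1) that by (force simp: capacity_def)
  \<comment> \<open>Here \<mu> and \<nu> agree, so the bounds determine \<open>P\<close>.\<close>
  moreover have "P {} = 0" "P \<Omega> = 1"
    using bounds[of "{}"] bounds[of \<Omega>] caps by (auto simp: capacity_def)
  moreover have "P A \<le> P B" if "A \<in> \<B>" "B \<in> \<B>" "A \<subseteq> B" for A B
  proof -
    have "A \<union> (B - A) = B" "A \<inter> (B - A) = {}" using that by auto
    moreover have "B - A \<in> \<B>" using that by auto
    ultimately show ?thesis
      using modular[of A "B - A"] nonneg[of "B - A"] \<open>P {} = 0\<close> that by auto
  qed
  ultimately have "probability_capacity \<Omega> \<B> P"
    using nonneg modular by (auto simp: probability_capacity_def capacity_def)
  then show ?thesis
    using bounds by (auto simp: capacity_ge_def)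
qed

end
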